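(* Let $K,N\ge 1$, $NK<m$, let $\mathbf{\Phi}\in\mathbb{R}^{m\times n}$, let $\mathbf{x}\in\mathbb{R}^n$ be $K$-sparse, and let $\mathbf{y}=\mathbf{\Phi}\mathbf{x}$. If $\mathbf{\Phi}$ satisfies the restricted isometry property (RIP) of order $NK$ with RIP constant $$\delta_{NK}<\frac{\sqrt{N}}{\sqrt{K}+2\sqrt{N}},$$ then the generalized orthogonal matching pursuit algorithm (gOMP), selecting $N$ atoms per iteration and applied to input $(\mathbf{y},\mathbf{\Phi})$, recovers $\mathbf{x}$ exactly by its $K$-th iteration.
   Context: A vector is $K$-sparse if it has at most $K$ nonzero entries. For an index set $I\subseteq\{1,\dots,n\}$, $\mathbf{\Phi}_I$ is the submatrix of $\mathbf{\Phi}$ with columns indexed by $I$; $\phi_j$ is the $j$-th column of $\mathbf{\Phi}$. RIP: $\mathbf{\Phi}\in\mathbb{R}^{m\times n}$ satisfies RIP of order $L$ if there is $\delta\in(0,1)$ such that for all $I\subseteq\{1,\dots,n\}$ with $|I|\le L$ and all $\mathbf{q}\in\mathbb{R}^{I}$, $(1-\delta)\|\mathbf{q}\|_2^2\le\|\mathbf{\Phi}_I\mathbf{q}\|_2^2\le(1+\delta)\|\mathbf{q}\|_2^2$. The RIP constant $\delta_L$ is the smallest $\delta$ for which these inequalities hold. gOMP algorithm (input $\mathbf{y}\in\mathbb{R}^m$, $\mathbf{\Phi}\in\mathbb{R}^{m\times n}$, parameters $K,N$ with $NK<m$): set $k=0$, $\mathbf{r}^0=\mathbf{y}$, $\Lambda^0=\emptyset$.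 While $k<K$ and $\|\mathbf{r}^k\|_2<\|\mathbf{r}^{k-1}\|_2$ (the second condition being vacuous for $k=0$): replace $k$ by $k+1$; let $h^k$ be a set of $N$ indices $j\in\{1,\dots,n\}$ for which $|\langle \mathbf{r}^{k-1},\phi_j\rangle|$ is largest; put $\Lambda^k=\Lambda^{k-1}\cup h^k$; let $\mathbf{x}_{\Lambda^k}$ be the minimizer of $\|\mathbf{y}-\mathbf{\Phi}\mathbf{z}\|_2$ over $\mathbf{z}\in\mathbb{R}^n$ supported in $\Lambda^k$; put $\mathbf{r}^k=\mathbf{y}-\mathbf{\Phi}\mathbf{x}_{\Lambda^k}$. The output is the last least-squares estimate $\mathbf{x}_{\Lambda^k}$. It is assumed that the matrices $\mathbf{\Phi}_{\Lambda^k}$ have full column rank. Exact recovery means that the output equals $\mathbf{x}$.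
   Formalization: The case K = N = 1 is excluded, because there the claim is false: for Φ with columns (1,0) and (1.1,0) and x = e₁, δ₁ = 0.21 < 1/3, yet gOMP selects the second column and does not return x. *)

theory Defs
  imports "HOL-Analysis.Analysis"
begin

definition k_sparse :: "nat \<Rightarrow> real ^ 'n \<Rightarrow> bool" where
  "k_sparse K x \<longleftrightarrow> card {j. x $ j \<noteq> 0} \<le> K"

(* The product of the column submatrix of A indexed by I with a vector q in R^I;
   only the values of q on I matter. *)
definition submatrix_mult :: "real ^ 'n ^ 'm \<Rightarrow> 'n set \<Rightarrow> ('n \<Rightarrow> real) \<Rightarrow> real ^ 'm" where
  "submatrix_mult A I q = (\<Sum>j\<in>I. q j *\<^sub>R column j A)"

definition rip_bounds :: "real ^ 'n ^ 'm \<Rightarrow> nat \<Rightarrow> real \<Rightarrow> bool" where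
  "rip_bounds A L \<delta> \<longleftrightarrow>
     (\<forall>I q. card I \<le> L \<longrightarrow>
        (1 - \<delta>) * (\<Sum>j\<in>I. (q j)\<^sup>2) \<le> (norm (submatrix_mult A I q))\<^sup>2 \<and>
        (norm (submatrix_mult A I q))\<^sup>2 \<le> (1 + \<delta>) * (\<Sum>j\<in>I. (q j)\<^sup>2))"

definition satisfies_rip :: "real ^ 'n ^ 'm \<Rightarrow> nat \<Rightarrow> bool" where
  "satisfies_rip A L \<longleftrightarrow> (\<exists>\<delta>. 0 < \<delta> \<and> \<delta> < 1 \<and> rip_bounds A L \<delta>)"

(* For L >= 1 the infimum is attained, see rip_bounds_rip_const: it is the smallest
   admissible value. *)
definition rip_const :: "real ^ 'n ^ 'm \<Rightarrow> nat \<Rightarrow> real" where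
  "rip_const A L = Inf {\<delta>. rip_bounds A L \<delta>}"

definition full_column_rank :: "real ^ 'n ^ 'm \<Rightarrow> 'n set \<Rightarrow> bool" where
  "full_column_rank A I \<longleftrightarrow> dim ((\<lambda>j. column j A) ` I) = card I"

(* h consists of N indices with largest absolute correlation; any tie-breaking is allowed. *)
definition top_correlated :: "nat \<Rightarrow> real ^ 'n ^ 'm \<Rightarrow> real ^ 'm \<Rightarrow> 'n set \<Rightarrow> bool" where
  "top_correlated N A r h \<longleftrightarrow>
     card h = N \<and> (\<forall>i\<in>h. \<forall>j. j \<notin> h \<longrightarrow> \<bar>r \<bullet> column j A\<bar> \<le> \<bar>r \<bullet> column i A\<bar>)"

definition least_squares :: "real ^ 'n ^ 'm \<Rightarrow> real ^ 'm \<Rightarrow> 'n set \<Rightarrow> real ^ 'n \<Rightarrow> bool" where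
  "least_squares A y S z \<longleftrightarrow>
     is_arg_min (\<lambda>v. norm (y - A *v v)) (\<lambda>v. \<forall>j. j \<notin> S \<longrightarrow> v $ j = 0) z"

definition gomp_continue :: "nat \<Rightarrow> (nat \<Rightarrow> real ^ 'm) \<Rightarrow> nat \<Rightarrow> bool" where
  "gomp_continue K r k \<longleftrightarrow> k < K \<and> (k = 0 \<or> norm (r k) < norm (r (k - 1)))"

(* A complete run stopping after t iterations: index sets S k, least-squares estimates z k
   (k >= 1; the value z 0 is irrelevant) and residuals r k.  Its output is z t. *)
definition gomp_run ::
  "nat \<Rightarrow> nat \<Rightarrow> real ^ 'm \<Rightarrow> real ^ 'n ^ 'm \<Rightarrow>
   (nat \<Rightarrow> 'n set) \<Rightarrow> (nat \<Rightarrow> real ^ 'n) \<Rightarrow> (nat \<Rightarrow> real ^ 'm) \<Rightarrow> nat \<Rightarrow> bool" where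
  "gomp_run K N y A S z r t \<longleftrightarrow>
     r 0 = y \<and> S 0 = {} \<and>
     (\<forall>k<t. gomp_continue K r k \<and>
        (\<exists>h. top_correlated N A (r k) h \<and> S (Suc k) = S k \<union> h) \<and>
        full_column_rank A (S (Suc k)) \<and>
        least_squares A y (S (Suc k)) (z (Suc k)) \<and>
        r (Suc k) = y - A *v z (Suc k)) \<and>
     \<not> gomp_continue K r t"

lemma rip_bounds_nonneg:
  fixes A :: "real ^ 'n ^ 'm"
  assumes "rip_bounds A L \<delta>" "1 \<le> L"
  shows "0 \<le> \<delta>"
proof -
  obtain j :: 'n where True by simp
  have "card {j} \<le> L" using assms(2) by simp
  with assms(1) have "(1 - \<delta>) * (\<Sum>j\<in>{j}. (1::real)\<^sup>2) \<le> (1 + \<delta>) * (\<Sum>j\<in>{j}. (1::real)\<^sup>2)"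
    unfolding rip_bounds_def by (meson order_trans)
  then show ?thesis by simp
qed

lemma rip_bounds_rip_const:
  fixes A :: "real ^ 'n ^ 'm"
  assumes "satisfies_rip A L" "1 \<le> L"
  shows "rip_bounds A L (rip_const A L)"
proof -
  let ?D = "{\<delta>. rip_bounds A L \<delta>}"
  have ne: "?D \<noteq> {}" using assms(1) by (auto simp: satisfies_rip_def)
  have bb: "bdd_below ?D" using rip_bounds_nonneg[OF _ assms(2)] by (auto intro!: bdd_belowI[of _ 0])
  have "?D = (\<Inter>I. \<Inter>q. {\<delta>. card I \<le> L \<longrightarrow>
        (1 - \<delta>) * (\<Sum>j\<in>I. (q j)\<^sup>2) \<le> (norm (submatrix_mult A I q))\<^sup>2 \<and>
        (norm (submatrix_mult A I q))\<^sup>2 \<le> (1 + \<delta>) * (\<Sum>j\<in>I. (q j)\<^sup>2)})"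
    by (auto simp: rip_bounds_def)
  also have "closed \<dots>"
    by (intro closed_INT ballI closed_Collect_imp open_Collect_const closed_Collect_conj
        closed_Collect_le continuous_on_mult continuous_on_diff continuous_on_add
        continuous_on_id continuous_on_const)
  finally have "closed ?D" .
  from closed_contains_Inf[OF ne bb this] show ?thesis by (simp add: rip_const_def)
qed

(* For K = N = 1 the recovery guarantee fails, because RIP of order 1 only constrains the
   norms of the columns: here the columns are parallel and the longer, wrong one is selected. *)
lemma gomp_failure_1_1:
  "\<exists>(A :: real ^ 2 ^ 2) x S z r t.
     1 * 1 < CARD(2) \<and> k_sparse 1 x \<and> satisfies_rip A (1 * 1) \<and>
     rip_const A (1 * 1) < sqrt (real 1) / (sqrt (real 1) + 2 * sqrt (real 1)) \<and>
     gomp_run 1 1 (A *v x) A S z r t \<and> z t \<noteq> x"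
proof -
  define A :: "real ^ 2 ^ 2" where "A = (\<chi> i j. if i = 1 then (if j = 1 then 1 else 11/10) else 0)"
  define x :: "real ^ 2" where "x = axis 1 1"
  define w :: "real ^ 2" where "w = axis 2 (10/11)"
  define S :: "nat \<Rightarrow> 2 set" where "S k = (if k = 0 then {} else {2})" for k
  define r :: "nat \<Rightarrow> real ^ 2" where "r k = (if k = 0 then A *v x else 0)" for k
  have col: "column 1 A = axis 1 1" "column 2 A = axis 1 (11/10)"
    by (auto simp: A_def column_def axis_def vec_eq_iff)
  have Ax: "A *v x = axis 1 1" and Aw: "A *v w = axis 1 1"
    by (auto simp: A_def x_def w_def axis_def vec_eq_iff matrix_vector_mult_def sum_2)
  have nrm: "(norm (column j A))\<^sup>2 \<in> {1 .. 121/100}" for j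
    using exhaust_2[of j] by (auto simp: col power2_norm_eq_inner inner_axis_axis)
  have rb: "rip_bounds A (1*1) (21/100)"
    unfolding rip_bounds_def
  proof (intro allI impI)
    fix I :: "2 set" and q assume "card I \<le> 1 * 1"
    then consider "I = {}" | j where "I = {j}"
      by (auto simp: le_Suc_eq card_1_singleton_iff)
    then show "(1 - 21/100) * (\<Sum>j\<in>I. (q j)\<^sup>2) \<le> (norm (submatrix_mult A I q))\<^sup>2 \<and>
        (norm (submatrix_mult A I q))\<^sup>2 \<le> (1 + 21/100) * (\<Sum>j\<in>I. (q j)\<^sup>2)"
    proof cases
      case 1 then show ?thesis by (simp add: submatrix_mult_def)
    next
      case (2 j)
      have "(q j)\<^sup>2 * 1 \<le> (q j)\<^sup>2 * (norm (column j A))\<^sup>2"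
        "(q j)\<^sup>2 * (norm (column j A))\<^sup>2 \<le> (q j)\<^sup>2 * (121/100)"
        using nrm[of j] by (intro mult_left_mono; simp)+
      moreover have "0 \<le> (q j)\<^sup>2" by simp
      ultimately show ?thesis unfolding 2 submatrix_mult_def by (simp add: power_mult_distrib)
    qed
  qed
  have rip: "satisfies_rip A (1*1)"
    unfolding satisfies_rip_def using rb by (intro exI[of _ "21/100"]) simp
  have "rip_const A (1*1) \<le> 21/100"
    unfolding rip_const_def using rb rip_bounds_nonneg[of A "1*1"]
    by (intro cInf_lower) (auto intro!: bdd_belowI[of _ 0])
  then have rc: "rip_const A (1*1) < sqrt (real 1) / (sqrt (real 1) + 2 * sqrt (real 1))" by simp
  have "{j. x $ j \<noteq> 0} = {1}" by (auto simp: x_def axis_def)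
  then have sp: "k_sparse 1 x" by (simp add: k_sparse_def)
  have tc: "top_correlated 1 A (r 0) {2}"
    unfolding top_correlated_def
  proof (intro conjI ballI allI impI)
    fix i j :: 2 assume "i \<in> {2}" "j \<notin> {2}"
    then have "i = 2" "j = 1" using exhaust_2[of j] by auto
    then show "\<bar>r 0 \<bullet> column j A\<bar> \<le> \<bar>r 0 \<bullet> column i A\<bar>"
      by (simp add: col r_def Ax inner_axis_axis)
  qed simp
  have fr: "full_column_rank A {2}"
    by (simp add: full_column_rank_def col axis_eq_0_iff)
  have ls: "least_squares A (A *v x) {2} w"
    by (auto simp: least_squares_def is_arg_min_def Ax Aw) (auto simp: w_def axis_def)
  have "gomp_run 1 1 (A *v x) A S (\<lambda>_. w) r 1"
    unfolding gomp_run_def using tc fr ls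
    by (auto simp: S_def gomp_continue_def Ax Aw) (auto simp: r_def Ax)
  moreover have "w \<noteq> x" by (auto simp: w_def x_def axis_def vec_eq_iff)
  ultimately show ?thesis using sp rip rc
    by (intro exI[of _ A] exI[of _ x] exI[of _ S] exI[of _ "\<lambda>_. w"] exI[of _ r] exI[of _ 1]) simp
qed

end

theory Submission
  imports Defs
begin

text \<open>
  Let \<open>w\<close> be the error \<open>x - z k\<close>, supported on \<open>D \<union> E\<close> with \<open>E\<close> the selected and \<open>D\<close> the missing
  indices, and let \<open>u\<close> be the vector of correlations of the residual with the columns. By least
  squares, \<open>u\<close> vanishes on \<open>E\<close>, so RIP gives \<open>\<parallel>u\<parallel> \<ge> (1 - \<delta>) \<parallel>w\<parallel>\<close> on \<open>D\<close>. If the next \<open>N\<close> indices \<open>h\<close>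
  all missed \<open>D\<close>, then \<open>\<parallel>u\<parallel>\<close> on \<open>h\<close> would be at most \<open>\<delta> (1 + 1 / \<surd>|D|) \<parallel>w\<parallel>\<close>, and comparing entries
  of \<open>u\<close> on \<open>h\<close> and \<open>D\<close> contradicts the bound on \<open>\<delta>\<close>. So every iteration finds a new support index
  and strictly decreases the residual until the support is exhausted.

  The set \<open>h \<union> D \<union> E\<close> may have \<open>NK + 1\<close> elements, one more than RIP controls. For \<open>K \<ge> 2\<close> the
  entry of \<open>w\<close> on \<open>D\<close> of least modulus, at most \<open>\<parallel>w\<parallel> / \<surd>|D|\<close>, is therefore split off and treated
  separately; this costs the term \<open>1 / \<surd>|D|\<close>. For \<open>K = 1\<close> one element of \<open>h\<close> is dropped instead.
\<close>

section \<open>Supports, restrictions and the Gram operator\<close>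

definition supported_on :: "'n set \<Rightarrow> real ^ 'n \<Rightarrow> bool" where
  "supported_on I v \<longleftrightarrow> (\<forall>j. j \<notin> I \<longrightarrow> v $ j = 0)"

definition vrestrict :: "'n set \<Rightarrow> real ^ 'n \<Rightarrow> real ^ 'n" where
  "vrestrict I v = (\<chi> j. if j \<in> I then v $ j else 0)"

text \<open>When \<open>v\<close> is the error \<open>x - z\<close>, the entries of this vector are
  the signed correlations that gOMP ranks by modulus.\<close>

definition gram :: "real ^ 'n ^ 'm \<Rightarrow> real ^ 'n \<Rightarrow> real ^ 'n" where
  "gram A v = transpose A *v (A *v v)"

lemma gram_nth: "gram A v $ j = (A *v v) \<bullet> column j A"
  by (simp add: gram_def matrix_vector_mult_def transpose_def column_def inner_vec_def mult.commute)

lemma gram_add: "gram A (v + w) = gram A v + gram A w"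
  by (simp add: gram_def matrix_vector_right_distrib)

lemma inner_gram: "gram A v \<bullet> w = (A *v v) \<bullet> (A *v w)"
  by (simp add: gram_def dot_lmul_matrix[symmetric] inner_commute)

lemma vrestrict_nth [simp]: "vrestrict I v $ j = (if j \<in> I then v $ j else 0)"
  by (simp add: vrestrict_def)

lemma vrestrict_add: "vrestrict I (v + w) = vrestrict I v + vrestrict I w"
  by (simp add: vec_eq_iff)

lemma supported_on_vrestrict: "supported_on I (vrestrict I v)"
  by (simp add: supported_on_def)

lemma supported_on_mono: "supported_on I v \<Longrightarrow> I \<subseteq> J \<Longrightarrow> supported_on J v"
  by (auto simp: supported_on_def)

lemma supported_on_add: "supported_on I v \<Longrightarrow> supported_on I w \<Longrightarrow> supported_on I (v + w)"
  by (auto simp: supported_on_def)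

lemma supported_on_diff: "supported_on I v \<Longrightarrow> supported_on I w \<Longrightarrow> supported_on I (v - w)"
  by (auto simp: supported_on_def)

lemma norm_supported_on:
  assumes "supported_on I v"
  shows "(norm v)\<^sup>2 = (\<Sum>j\<in>I. (v $ j)\<^sup>2)"
proof -
  have "(norm v)\<^sup>2 = (\<Sum>j\<in>UNIV. (v $ j)\<^sup>2)"
    by (simp only: power2_norm_eq_inner inner_vec_def) (simp add: power2_eq_square)
  also have "\<dots> = (\<Sum>j\<in>I. (v $ j)\<^sup>2)"
    by (rule sum.mono_neutral_right) (use assms in \<open>auto simp: supported_on_def\<close>)
  finally show ?thesis .
qed

lemma norm_vrestrict: "(norm (vrestrict I v))\<^sup>2 = (\<Sum>j\<in>I. (v $ j)\<^sup>2)"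
  by (simp add: norm_supported_on[OF supported_on_vrestrict])

lemma norm_vrestrict_le: "norm (vrestrict I v) \<le> norm v"
  by (rule norm_le_componentwise_cart) simp

lemma norm_vrestrict_upper:
  assumes "\<And>j. j \<in> I \<Longrightarrow> \<bar>v $ j\<bar> \<le> a" "0 \<le> a"
  shows "norm (vrestrict I v) \<le> sqrt (real (card I)) * a"
proof (rule power2_le_imp_le)
  have "(\<Sum>j\<in>I. (v $ j)\<^sup>2) \<le> (\<Sum>j\<in>I. a\<^sup>2)"
    using assms by (intro sum_mono) (simp add: abs_le_square_iff[symmetric])
  then show "(norm (vrestrict I v))\<^sup>2 \<le> (sqrt (real (card I)) * a)\<^sup>2"
    by (simp add: norm_vrestrict power_mult_distrib)
qed (use assms in auto)

lemma norm_vrestrict_lower: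
  assumes "\<And>j. j \<in> I \<Longrightarrow> a \<le> \<bar>v $ j\<bar>" "0 \<le> a"
  shows "sqrt (real (card I)) * a \<le> norm (vrestrict I v)"
proof (rule power2_le_imp_le)
  have "(\<Sum>j\<in>I. a\<^sup>2) \<le> (\<Sum>j\<in>I. (v $ j)\<^sup>2)"
    using assms by (intro sum_mono) (simp add: abs_le_square_iff[symmetric])
  then show "(sqrt (real (card I)) * a)\<^sup>2 \<le> (norm (vrestrict I v))\<^sup>2"
    by (simp add: norm_vrestrict power_mult_distrib)
qed auto

section \<open>Consequences of the restricted isometry property\<close>

lemma submatrix_mult_eq:
  assumes "supported_on I v"
  shows "submatrix_mult A I (\<lambda>j. v $ j) = A *v v"
proof -
  have "A *v v = (\<Sum>j\<in>UNIV. v $ j *\<^sub>R column j A)"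
    by (simp add: matrix_mult_sum scalar_mult_eq_scaleR)
  also have "\<dots> = (\<Sum>j\<in>I. v $ j *\<^sub>R column j A)"
    by (rule sum.mono_neutral_right) (use assms in \<open>auto simp: supported_on_def\<close>)
  finally show ?thesis by (simp add: submatrix_mult_def)
qed

lemma rip_bounds_supported:
  assumes "rip_bounds A L \<delta>" "supported_on I v" "card I \<le> L"
  shows "(1 - \<delta>) * (norm v)\<^sup>2 \<le> (norm (A *v v))\<^sup>2"
    and "(norm (A *v v))\<^sup>2 \<le> (1 + \<delta>) * (norm v)\<^sup>2"
  using assms(1)[unfolded rip_bounds_def, rule_format, OF assms(3), of "\<lambda>j. v $ j"]
  unfolding submatrix_mult_eq[OF assms(2)] norm_supported_on[OF assms(2)] by auto

text \<open>Polarization: for orthogonal unit vectors \<open>p\<close>, \<open>q\<close> both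
  \<open>p + q\<close> and \<open>p - q\<close> have squared norm 2, so the two RIP inequalities
  leave a gap of at most 2(1 + \<delta>) - 2(1 - \<delta>) = 4\<delta>. Normalizing first yields the
  product of the norms.\<close>

lemma rip_bounds_inner:
  assumes rip: "rip_bounds A L \<delta>" and v: "supported_on I v" and w: "supported_on J w"
    and IJ: "I \<inter> J = {}" "card (I \<union> J) \<le> L"
  shows "(A *v v) \<bullet> (A *v w) \<le> \<delta> * norm v * norm w"
proof (cases "v = 0 \<or> w = 0")
  case True
  then show ?thesis by auto
next
  case False
  have orth: "v \<bullet> w = 0"
    unfolding inner_vec_def using v w IJ(1)
    by (intro sum.neutral) (auto simp: supported_on_def)
  define p where "p = v /\<^sub>R norm v"
  define q where "q = w /\<^sub>R norm w"
  have n: "p \<bullet> p = 1" "q \<bullet> q = 1" "p \<bullet> q = 0"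
    using False orth by (auto simp: p_def q_def dot_square_norm power2_eq_square field_simps)
  have pq: "supported_on (I \<union> J) p" "supported_on (I \<union> J) q"
    using v w by (auto simp: p_def q_def supported_on_def)
  have "(norm (A *v (p + q)))\<^sup>2 \<le> (1 + \<delta>) * (norm (p + q))\<^sup>2"
    "(1 - \<delta>) * (norm (p - q))\<^sup>2 \<le> (norm (A *v (p - q)))\<^sup>2"
    using rip_bounds_supported[OF rip _ IJ(2)] supported_on_add[OF pq] supported_on_diff[OF pq]
    by blast+
  moreover have "(norm (p + q))\<^sup>2 = 2" "(norm (p - q))\<^sup>2 = 2"
    using n by (simp_all add: power2_norm_eq_inner inner_simps inner_commute)
  moreover have "(norm (A *v (p + q)))\<^sup>2 - (norm (A *v (p - q)))\<^sup>2 = 4 * ((A *v p) \<bullet> (A *v q))"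
    by (simp add: power2_norm_eq_inner inner_simps inner_commute
        matrix_vector_right_distrib matrix_vector_mult_diff_distrib)
  ultimately have "(A *v p) \<bullet> (A *v q) \<le> \<delta>" by simp
  then show ?thesis
    using False by (simp add: p_def q_def matrix_vector_mult_scaleR field_simps)
qed

text \<open>Duality: pair \<open>gram A v\<close> with its own restriction to \<open>I\<close>,
  apply \<open>rip_bounds_inner\<close>, and cancel one factor of the norm.\<close>

lemma rip_gram_upper:
  assumes rip: "rip_bounds A L \<delta>" and v: "supported_on J v"
    and IJ: "I \<inter> J = {}" "card (I \<union> J) \<le> L"
  shows "norm (vrestrict I (gram A v)) \<le> \<delta> * norm v"
proof (cases "vrestrict I (gram A v) = 0")
  case True
  have "0 \<le> \<delta> * norm v"
  proof (cases "v = 0")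
    case False
    \<comment> \<open>For \<open>L = 0\<close> a negative \<delta> would be admissible; a nonzero
      \<open>v\<close> makes \<open>J\<close> nonempty and excludes this.\<close>
    then have "1 \<le> L"
      using v IJ(2) by (auto simp: supported_on_def vec_eq_iff Suc_le_eq card_gt_0_iff
          intro: order.strict_trans2[rotated])
    then show ?thesis using rip_bounds_nonneg[OF rip] by simp
  qed simp
  with True show ?thesis by simp
next
  case False
  let ?p = "vrestrict I (gram A v)"
  have "(norm ?p)\<^sup>2 = gram A v \<bullet> ?p"
    by (simp add: power2_norm_eq_inner inner_vec_def if_distrib cong: if_cong)
  also have "\<dots> = (A *v ?p) \<bullet> (A *v v)" by (simp add: inner_gram inner_commute)
  also have "\<dots> \<le> \<delta> * norm ?p * norm v"
    by (rule rip_bounds_inner[OF rip supported_on_vrestrict v IJ])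
  finally show ?thesis using False by (simp add: power2_eq_square mult.commute)
qed

text \<open>The squared norm of \<open>A *v v\<close> equals \<open>gram A v \<bullet> v\<close>, to
  which only the indices in \<open>D\<close> contribute. RIP bounds it from below and Cauchy-Schwarz
  from above.\<close>

lemma rip_gram_lower:
  assumes rip: "rip_bounds A L \<delta>" and v: "supported_on (D \<union> E) v" and L: "card (D \<union> E) \<le> L"
    and E: "\<And>i. i \<in> E \<Longrightarrow> gram A v $ i = 0"
  shows "(1 - \<delta>) * norm v \<le> norm (vrestrict D (gram A v))"
proof (cases "v = 0")
  case False
  have "(1 - \<delta>) * (norm v)\<^sup>2 \<le> (norm (A *v v))\<^sup>2"
    using rip_bounds_supported[OF rip v L] by simp
  also have "\<dots> = gram A v \<bullet> v" by (simp add: inner_gram power2_norm_eq_inner)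
  also have "\<dots> = vrestrict D (gram A v) \<bullet> v"
    unfolding inner_vec_def using v E by (intro sum.cong) (auto simp: supported_on_def)
  also have "\<dots> \<le> norm (vrestrict D (gram A v)) * norm v" by (rule norm_cauchy_schwarz)
  finally show ?thesis using False by (simp add: power2_eq_square)
qed simp

lemma rip_injective:
  assumes "rip_bounds A L \<delta>" "\<delta> < 1" "supported_on I v" "card I \<le> L" "A *v v = 0"
  shows "v = 0"
proof -
  have "(1 - \<delta>) * (norm v)\<^sup>2 \<le> 0"
    using rip_bounds_supported(1)[OF assms(1,3,4)] assms(5) by simp
  then show ?thesis using assms(2) by (simp add: mult_le_0_iff)
qed

lemma rip_full_column_rank:
  assumes rip: "rip_bounds A L \<delta>" "\<delta> < 1" and I: "card I \<le> L"
  shows "full_column_rank A I"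
proof -
  have zero: "q i = 0" if "(\<Sum>j\<in>I. q j *\<^sub>R column j A) = 0" "i \<in> I" for q i
  proof -
    let ?v = "vrestrict I (\<chi> j. q j)"
    have "A *v ?v = (\<Sum>j\<in>I. q j *\<^sub>R column j A)"
      using submatrix_mult_eq[OF supported_on_vrestrict, of A I "\<chi> j. q j"]
      by (simp add: submatrix_mult_def)
    then have "?v = 0" using rip_injective[OF rip supported_on_vrestrict I] that(1) by simp
    then show ?thesis using that(2) by (auto simp: vec_eq_iff split: if_splits)
  qed
  \<comment> \<open>\<open>full_column_rank\<close> speaks of the set of columns, so repeated
    columns must be excluded before a sum over that set can be indexed by \<open>I\<close>.\<close>
  have inj: "inj_on (\<lambda>j. column j A) I"
  proof (rule inj_onI, rule ccontr)
    fix i j assume *: "i \<in> I" "j \<in> I" "column i A = column j A" "i \<noteq> j"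
    let ?q = "\<lambda>k. if k = i then 1 else if k = j then -1 else (0::real)"
    have "(\<Sum>k\<in>I. ?q k *\<^sub>R column k A) = (\<Sum>k\<in>{i, j}. ?q k *\<^sub>R column k A)"
      by (rule sum.mono_neutral_right) (use * in auto)
    also have "\<dots> = 0" using * by simp
    finally show False using zero[of ?q i] * by simp
  qed
  have "independent ((\<lambda>j. column j A) ` I)"
    unfolding independent_explicit
  proof (intro conjI allI impI ballI)
    fix c v assume c: "(\<Sum>v\<in>(\<lambda>j. column j A) ` I. c v *\<^sub>R v) = 0" and "v \<in> (\<lambda>j. column j A) ` I"
    then obtain i where i: "i \<in> I" "v = column i A" by auto
    have "(\<Sum>j\<in>I. c (column j A) *\<^sub>R column j A) = 0"
      using c by (simp add: sum.reindex[OF inj])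
    from zero[OF this i(1)] i(2) show "c v = 0" by simp
  qed simp
  then show ?thesis
    by (simp add: full_column_rank_def dim_eq_card_independent card_image[OF inj])
qed

section \<open>One selection step\<close>

lemma gomp_selects_correct_index:
  fixes A :: "real ^ 'n ^ 'm"
  assumes rip: "rip_bounds A (N * K) \<delta>"
    and \<delta>: "\<delta> < sqrt (real N) / (sqrt (real K) + 2 * sqrt (real N))"
    and KN: "1 \<le> N" "\<not> (K = 1 \<and> N = 1)" and k: "k < K"
    and DE: "D \<inter> E = {}" "D \<noteq> {}" "card D \<le> K - k" "card E \<le> N * k"
    and w: "supported_on (D \<union> E) w" "w \<noteq> 0"
    and E: "\<And>i. i \<in> E \<Longrightarrow> gram A w $ i = 0"
    and h: "top_correlated N A (A *v w) h"
  shows "h \<inter> D \<noteq> {}"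
proof
  assume hD: "h \<inter> D = {}"
  let ?u = "gram A w" and ?W = "norm w"
  define d where "d = card D"
  have d: "1 \<le> d" "d \<le> K" using DE by (auto simp: d_def Suc_le_eq card_gt_0_iff)
  have W: "0 < ?W" using w by simp
  have NK: "1 \<le> N * K" using KN k by (cases N; cases K) auto
  have \<delta>0: "0 \<le> \<delta>" using rip_bounds_nonneg[OF rip NK] .
  have sK: "1 \<le> sqrt (real K)" and sN: "1 \<le> sqrt (real N)" using k KN by auto
  have \<delta>1: "\<delta> * (sqrt (real K) + 2 * sqrt (real N)) < sqrt (real N)"
    using \<delta> sK sN by (simp add: pos_less_divide_eq)
  have \<delta>2: "\<delta> < 1/2"
  proof -
    have "\<delta> * (2 * sqrt (real N)) \<le> \<delta> * (sqrt (real K) + 2 * sqrt (real N))"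
      using \<delta>0 sK by (intro mult_left_mono) auto
    with \<delta>1 have "\<delta> * (2 * sqrt (real N)) < (1/2) * (2 * sqrt (real N))" by simp
    then show ?thesis using sN by (subst (asm) mult_less_cancel_right_pos) auto
  qed
  have cardh: "card h = N"
    and top: "\<And>i j. i \<in> h \<Longrightarrow> j \<notin> h \<Longrightarrow> \<bar>?u $ j\<bar> \<le> \<bar>?u $ i\<bar>"
    using h by (auto simp: top_correlated_def gram_nth)
  have "h \<noteq> {}" using cardh KN by auto
  \<comment> \<open>The threshold \<open>a\<close> separates the two sets: correlations are at least
    \<open>a\<close> on \<open>h\<close> and, as \<open>D\<close> misses \<open>h\<close>, at most
    \<open>a\<close> on \<open>D\<close>.\<close>
  define a where "a = Min ((\<lambda>i. \<bar>?u $ i\<bar>) ` h)"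
  have a_le: "a \<le> \<bar>?u $ i\<bar>" if "i \<in> h" for i using that by (simp add: a_def)
  have "a \<in> (\<lambda>i. \<bar>?u $ i\<bar>) ` h" unfolding a_def using \<open>h \<noteq> {}\<close> by (intro Min_in) auto
  then obtain i0 where i0: "i0 \<in> h" "a = \<bar>?u $ i0\<bar>" by auto
  have D_le: "\<bar>?u $ j\<bar> \<le> a" if "j \<in> D" for j using top[OF i0(1), of j] that hD i0(2) by auto
  have a0: "0 \<le> a" using i0 by simp
  have cDE: "card D + card E \<le> (K - k) + N * k" using DE by simp
  \<comment> \<open>The slack is (N - 1)(K - k - 1), so the excess of one over the RIP order does
    occur for N = 1 and in the last iteration k = K - 1.\<close>
  have kN: "(K - k) + N * k + N \<le> N * K + 1"
  proof -
    obtain m n where mn: "K = Suc (k + m)" "N = Suc n"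
      using k KN by (metis Suc_le_D less_imp_Suc_add One_nat_def)
    show ?thesis by (simp add: mn algebra_simps)
  qed
  have lower: "(1 - \<delta>) * ?W \<le> sqrt (real d) * a"
  proof -
    have "card (D \<union> E) \<le> N * K" using card_Un_le[of D E] cDE kN KN by simp
    then have "(1 - \<delta>) * ?W \<le> norm (vrestrict D ?u)" by (rule rip_gram_lower[OF rip w(1) _ E])
    also have "\<dots> \<le> sqrt (real d) * a"
      unfolding d_def by (rule norm_vrestrict_upper[OF D_le a0])
    finally show ?thesis .
  qed
  \<comment> \<open>Correlations vanish on \<open>E\<close>, so a positive threshold keeps
    \<open>h\<close> away from \<open>E\<close>, as \<open>rip_gram_upper\<close> requires.\<close>
  have "0 < a"
  proof -
    have "0 < (1 - \<delta>) * ?W" using W \<delta>2 by simp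
    with lower have "0 < sqrt (real d) * a" by linarith
    then show ?thesis using a0 by (simp add: zero_less_mult_iff)
  qed
  then have hE: "h \<inter> E = {}" using a_le E by fastforce
  show False
  proof (cases "K = 1")
    case True
    then have "2 \<le> N" "d = 1" "E = {}" using KN k d DE by auto
    \<comment> \<open>Dropping one index makes room for the single element of \<open>D\<close>;
      since N is at least 2, \<open>h'\<close> stays nonempty and still forces \<open>a\<close> to
      be at most \<delta> times the norm of \<open>w\<close>.\<close>
    define h' where "h' = h - {i0}"
    have h': "card h' = N - 1" using i0 cardh by (simp add: h'_def)
    have "sqrt (real (card h')) * a \<le> norm (vrestrict h' ?u)"
      using a_le a0 by (intro norm_vrestrict_lower) (auto simp: h'_def)
    also have "\<dots> \<le> \<delta> * ?W"
    proof (rule rip_gram_upper[OF rip w(1)])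
      show "h' \<inter> (D \<union> E) = {}" using hD hE by (auto simp: h'_def)
      show "card (h' \<union> (D \<union> E)) \<le> N * K"
        using card_Un_le[of h' D] h' \<open>E = {}\<close> \<open>d = 1\<close> \<open>2 \<le> N\<close> True by (simp add: d_def)
    qed
    finally have "sqrt (real (card h')) * a \<le> \<delta> * ?W" .
    moreover have "1 * a \<le> sqrt (real (card h')) * a"
      using \<open>2 \<le> N\<close> h' a0 by (intro mult_right_mono) auto
    ultimately have "(1 - \<delta>) * ?W \<le> \<delta> * ?W" using lower \<open>d = 1\<close> by simp
    then show False using W \<delta>2 by simp
  next
    case False
    then have "2 \<le> K" using k by simp
    then have N1: "N + 1 \<le> N * K"
      using KN by (cases N; cases K; cases "K - 1") auto
    obtain t where t: "t \<in> D" "\<And>j. j \<in> D \<Longrightarrow> \<bar>w $ t\<bar> \<le> \<bar>w $ j\<bar>"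
      using arg_min_if_finite[of D "\<lambda>j. \<bar>w $ j\<bar>"] DE(2)
      by (metis finite not_le)
    let ?w1 = "vrestrict {t} w" and ?w2 = "vrestrict (D \<union> E - {t}) w"
    have split: "w = ?w1 + ?w2" using w(1) t(1) by (auto simp: vec_eq_iff supported_on_def)
    \<comment> \<open>Each of the \<open>d\<close> entries of \<open>w\<close> on \<open>D\<close>
      is at least as large in modulus as the one at \<open>t\<close>.\<close>
    have w1: "sqrt (real d) * norm ?w1 \<le> ?W"
    proof -
      have "norm ?w1 \<le> \<bar>w $ t\<bar>" using norm_vrestrict_upper[of "{t}" w "\<bar>w $ t\<bar>"] by simp
      then have "sqrt (real d) * norm ?w1 \<le> sqrt (real d) * \<bar>w $ t\<bar>" by (simp add: mult_left_mono)
      also have "\<dots> \<le> norm (vrestrict D w)"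
        unfolding d_def using t by (intro norm_vrestrict_lower) auto
      also have "\<dots> \<le> ?W" by (rule norm_vrestrict_le)
      finally show ?thesis .
    qed
    have "sqrt (real N) * a \<le> norm (vrestrict h ?u)"
      using norm_vrestrict_lower[of h, OF a_le a0] cardh by simp
    also have "\<dots> \<le> norm (vrestrict h (gram A ?w1)) + norm (vrestrict h (gram A ?w2))"
      by (subst split, subst gram_add, subst vrestrict_add, rule norm_triangle_ineq)
    also have "norm (vrestrict h (gram A ?w1)) \<le> \<delta> * norm ?w1"
    proof (rule rip_gram_upper[OF rip supported_on_vrestrict])
      show "h \<inter> {t} = {}" using hD t by auto
      show "card (h \<union> {t}) \<le> N * K" using card_Un_le[of h "{t}"] cardh N1 by simp
    qed
    also have "norm (vrestrict h (gram A ?w2)) \<le> \<delta> * norm ?w2"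
    proof (rule rip_gram_upper[OF rip supported_on_vrestrict])
      show "h \<inter> (D \<union> E - {t}) = {}" using hD hE by auto
      have "card (D \<union> E - {t}) < card (D \<union> E)" using t(1) by (intro psubset_card_mono) auto
      then show "card (h \<union> (D \<union> E - {t})) \<le> N * K"
        using card_Un_le[of h "D \<union> E - {t}"] card_Un_le[of D E] cardh cDE kN by linarith
    qed
    also have "\<delta> * norm ?w2 \<le> \<delta> * ?W" using \<delta>0 by (intro mult_left_mono norm_vrestrict_le)
    finally have upper: "sqrt (real N) * a \<le> \<delta> * norm ?w1 + \<delta> * ?W" by simp
    \<comment> \<open>Combining \<open>lower\<close> and \<open>upper\<close> eliminates
      \<open>a\<close>. Of the two terms sqrt N in the denominator of the hypothesis, one comes from
      the factor 1 - \<delta>, the other from the split-off entry, whose contribution 1 is relaxed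
      to sqrt N.\<close>
    have "sqrt (real N) * ((1 - \<delta>) * ?W) \<le> sqrt (real N) * (sqrt (real d) * a)"
      using lower by (intro mult_left_mono) auto
    also have "\<dots> = sqrt (real d) * (sqrt (real N) * a)" by simp
    also have "\<dots> \<le> sqrt (real d) * (\<delta> * norm ?w1 + \<delta> * ?W)"
      using upper by (intro mult_left_mono) auto
    also have "\<dots> = \<delta> * (sqrt (real d) * norm ?w1 + sqrt (real d) * ?W)" by (simp add: algebra_simps)
    also have "\<dots> \<le> \<delta> * (sqrt (real N) * ?W + sqrt (real K) * ?W)"
    proof (intro mult_left_mono add_mono \<delta>0)
      have "1 * ?W \<le> sqrt (real N) * ?W" using sN W by (intro mult_right_mono) auto
      with w1 show "sqrt (real d) * norm ?w1 \<le> sqrt (real N) * ?W" by simp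
      show "sqrt (real d) * ?W \<le> sqrt (real K) * ?W" using d W by (intro mult_right_mono) auto
    qed
    finally have "sqrt (real N) * ?W \<le> (\<delta> * (sqrt (real K) + 2 * sqrt (real N))) * ?W"
      by (simp add: algebra_simps)
    then show False using \<delta>1 W by simp
  qed
qed

section \<open>Least squares and strict decrease of the residual\<close>

lemma norm_diff_less_if_correlated:
  fixes r c :: "'a :: real_inner"
  assumes "r \<bullet> c \<noteq> 0"
  obtains e where "norm (r - e *\<^sub>R c) < norm r"
proof
  have c: "0 < c \<bullet> c" using assms by auto
  let ?e = "(r \<bullet> c) / (c \<bullet> c)"
  have "(r - ?e *\<^sub>R c) \<bullet> (r - ?e *\<^sub>R c) = r \<bullet> r - (r \<bullet> c)\<^sup>2 / (c \<bullet> c)"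
    using c by (simp add: inner_diff_left inner_diff_right inner_commute field_simps power2_eq_square)
  also have "\<dots> < r \<bullet> r" using c assms by simp
  finally show "norm (r - ?e *\<^sub>R c) < norm r" by (simp add: norm_eq_sqrt_inner)
qed

lemma least_squares_alt:
  "least_squares A y S z \<longleftrightarrow>
     supported_on S z \<and> (\<forall>v. supported_on S v \<longrightarrow> norm (y - A *v z) \<le> norm (y - A *v v))"
  by (auto simp: least_squares_def is_arg_min_linorder supported_on_def)

text \<open>Moving \<open>v\<close> along coordinate \<open>i\<close> stays feasible and improves
  it. With \<open>v = z\<close> this yields the normal equations; with \<open>v\<close> the previous
  estimate it yields the strict decrease that keeps the loop running.\<close>

lemma least_squares_less:
  assumes z: "least_squares A y S z" and v: "supported_on S v"
    and i: "i \<in> S" "(y - A *v v) \<bullet> column i A \<noteq> 0"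
  shows "norm (y - A *v z) < norm (y - A *v v)"
proof -
  obtain e where e: "norm (y - A *v v - e *\<^sub>R column i A) < norm (y - A *v v)"
    using norm_diff_less_if_correlated[OF i(2)] .
  let ?v = "v + e *\<^sub>R axis i 1"
  have "supported_on S ?v" using v i(1) by (auto simp: supported_on_def axis_def)
  then have "norm (y - A *v z) \<le> norm (y - A *v ?v)" using z by (simp add: least_squares_alt)
  also have "A *v ?v = A *v v + e *\<^sub>R column i A"
    by (simp add: matrix_vector_right_distrib matrix_vector_mult_scaleR matrix_vector_mult_basis)
  finally show ?thesis using e by (simp add: diff_diff_eq)
qed

lemma least_squares_orthogonal:
  assumes "least_squares A y S z" "i \<in> S"
  shows "(y - A *v z) \<bullet> column i A = 0"
  using least_squares_less[OF assms(1) _ assms(2), of z] assms(1) by (auto simp: least_squares_alt)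

lemma least_squares_empty:
  fixes A :: "real ^ 'n ^ 'm"
  shows "least_squares A y {} 0"
proof -
  have "v = 0" if "supported_on {} v" for v :: "real ^ 'n"
    using that by (simp add: supported_on_def vec_eq_iff)
  moreover have "supported_on {} (0 :: real ^ 'n)" by (simp add: supported_on_def)
  ultimately show ?thesis unfolding least_squares_alt by blast
qed

text \<open>The image of a coordinate subspace is a finite-dimensional subspace, hence closed, so
  the distance from \<open>y\<close> to it is attained.\<close>

lemma least_squares_exists: "\<exists>z. least_squares A y S z"
proof -
  let ?V = "{v. supported_on S v}"
  have "subspace ((*v) A ` ?V)"
    by (intro linear_subspace_image matrix_vector_mul_linear)
      (auto simp: subspace_def supported_on_def)
  then have "closed ((*v) A ` ?V)" by (rule closed_subspace)
  moreover have "(*v) A ` ?V \<noteq> {}" by (auto simp: supported_on_def intro: exI[of _ 0])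
  ultimately obtain p where "p \<in> (*v) A ` ?V" "\<forall>q\<in>(*v) A ` ?V. dist y p \<le> dist y q"
    using distance_attains_inf[of _ y] by metis
  then show ?thesis by (auto simp: least_squares_alt dist_norm)
qed

text \<open>Greedy construction: \<open>h\<close> already dominates its complement, and the best
  index of the complement dominates whatever then remains outside.\<close>

lemma top_correlated_exists:
  fixes A :: "real ^ 'n ^ 'm"
  assumes "N \<le> CARD('n)"
  shows "\<exists>h. top_correlated N A r h"
  using assms
proof (induction N)
  case 0
  show ?case by (auto simp: top_correlated_def intro: exI[of _ "{}"])
next
  case (Suc N)
  then obtain h where h: "top_correlated N A r h" by auto
  have "h \<noteq> UNIV" using h Suc.prems by (auto simp: top_correlated_def)
  then have "- h \<noteq> {}" by auto
  then obtain t where t: "t \<in> - h" "\<And>j. j \<in> - h \<Longrightarrow> \<bar>r \<bullet> column j A\<bar> \<le> \<bar>r \<bullet> column t A\<bar>"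
    using arg_min_if_finite[of "- h" "\<lambda>j. - \<bar>r \<bullet> column j A\<bar>"]
    by (metis finite not_le neg_le_iff_le)
  have "top_correlated (Suc N) A r (insert t h)"
    using h t by (auto simp: top_correlated_def)
  then show ?case ..
qed

section \<open>Runs of the algorithm: correctness, then existence\<close>

lemma gomp_run_sound:
  fixes A :: "real ^ 'n ^ 'm"
  assumes rip: "rip_bounds A (N * K) \<delta>"
    and \<delta>: "\<delta> < sqrt (real N) / (sqrt (real K) + 2 * sqrt (real N))"
    and KN: "1 \<le> K" "1 \<le> N" "\<not> (K = 1 \<and> N = 1)"
    and sparse: "k_sparse K x" and run: "gomp_run K N (A *v x) A S z r t"
  shows "t \<le> K \<and> z t = x"
proof -
  have "sqrt (real N) / (sqrt (real K) + 2 * sqrt (real N)) < 1"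
    using KN by (simp add: field_simps add_pos_pos)
  with \<delta> have \<delta>1: "\<delta> < 1" by simp
  define T where "T = {j. x $ j \<noteq> 0}"
  have cardT: "card T \<le> K" using sparse by (simp add: k_sparse_def T_def)
  \<comment> \<open>A run leaves \<open>z 0\<close> arbitrary. The value 0 is the least-squares
    estimate on the empty set, so iteration 0 needs no separate treatment.\<close>
  define z' where "z' = z(0 := 0)"
  have step: "gomp_continue K r k" "\<exists>h. top_correlated N A (r k) h \<and> S (Suc k) = S k \<union> h"
    if "k < t" for k
    using run that by (auto simp: gomp_run_def)
  have stop: "\<not> gomp_continue K r t" using run by (simp add: gomp_run_def)
  have ls: "least_squares A (A *v x) (S k) (z' k)" and r: "r k = A *v (x - z' k)" if "k \<le> t" for k
    using run that
    by (cases k; simp add: z'_def gomp_run_def least_squares_empty Suc_le_eq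
        matrix_vector_mult_diff_distrib)+
  have supp: "supported_on ((T - S k) \<union> S k) (x - z' k)" if "k \<le> t" for k
    using ls[OF that] by (auto simp: least_squares_alt supported_on_def T_def)
  have orth: "gram A (x - z' k) $ i = 0" if "k \<le> t" "i \<in> S k" for k i
    using least_squares_orthogonal[OF ls[OF that(1)] that(2)]
    by (simp add: gram_nth matrix_vector_mult_diff_distrib)
  have nz: "x - z' k \<noteq> 0" if "k \<le> t" and ne: "T - S k \<noteq> {}" for k
  proof -
    obtain j where "j \<in> T" "j \<notin> S k" using ne by blast
    then show ?thesis using ls[OF that(1)]
      by (auto simp: least_squares_alt supported_on_def T_def)
  qed
  have t_le: "t \<le> K"
    using step(1)[of "t - 1"] by (cases t) (auto simp: gomp_continue_def)
  have t_pos: "0 < t" using stop KN by (cases t) (auto simp: gomp_continue_def)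
  \<comment> \<open>Each iteration adds at most \<open>N\<close> indices and, while support indices
    are missing, finds at least one of them.\<close>
  have inv: "card (S k) \<le> N * k \<and> card (T - S k) \<le> K - k" if "k \<le> t" for k
    using that
  proof (induction k)
    case 0
    have "S 0 = {}" using run by (simp add: gomp_run_def)
    then show ?case using cardT by simp
  next
    case (Suc k)
    then have kt: "k < t" and IH: "card (S k) \<le> N * k" "card (T - S k) \<le> K - k" by auto
    obtain h where h: "top_correlated N A (r k) h" "S (Suc k) = S k \<union> h"
      using step(2)[OF kt] by auto
    have "card (S (Suc k)) \<le> N * Suc k"
      using card_Un_le[of "S k" h] h IH by (simp add: top_correlated_def)
    moreover have "card (T - S (Suc k)) \<le> K - Suc k"
    proof (cases "T - S k = {}")
      case True
      then have "T - S (Suc k) = {}" using h by auto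
      then show ?thesis by (simp only: card.empty le0)
    next
      case False
      have "h \<inter> (T - S k) \<noteq> {}"
      proof (rule gomp_selects_correct_index[OF rip \<delta> KN(2,3) _ _ False IH(2,1)])
        show "k < K" using kt t_le by simp
        show "supported_on ((T - S k) \<union> S k) (x - z' k)" using supp kt by simp
        show "x - z' k \<noteq> 0" using nz False kt by simp
        show "top_correlated N A (A *v (x - z' k)) h" using h(1) r kt by simp
      qed (use orth kt in auto)
      then have "card (T - S (Suc k)) < card (T - S k)"
        using h(2) by (intro psubset_card_mono) auto
      then show ?thesis using IH(2) by simp
    qed
    ultimately show ?case ..
  qed
  have cardSt: "card (S t) \<le> N * K"
    using inv[OF order_refl] mult_le_mono2[OF t_le, of N] by linarith
  have TS: "T \<subseteq> S t"
  \<comment> \<open>A missing index means \<open>t < K\<close>, so the loop can only have stopped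
    because the residual did not decrease; the last iteration is shown to have decreased it.\<close>
  proof (rule ccontr)
    assume "\<not> T \<subseteq> S t"
    then have ne: "T - S t \<noteq> {}" by auto
    then have "0 < card (T - S t)" by (simp add: card_gt_0_iff)
    then have tK: "t < K" using inv[OF order_refl] by linarith
    obtain k where k: "t = Suc k" using t_pos by (cases t) auto
    obtain h where h: "top_correlated N A (r k) h" "S t = S k \<union> h" using step(2)[of k] k by auto
    have ne': "T - S k \<noteq> {}" using ne h by auto
    have kt: "k \<le> t" using k by simp
    \<comment> \<open>Otherwise \<open>gram\<close> vanishes on the whole support of the error, so
      the error is mapped to 0 and is 0 by RIP.\<close>
    have "\<exists>j\<in>T - S k. gram A (x - z' k) $ j \<noteq> 0"
    proof (rule ccontr)
      assume "\<not> (\<exists>j\<in>T - S k. gram A (x - z' k) $ j \<noteq> 0)"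
      then have "\<And>i. i \<in> (T - S k) \<union> S k \<Longrightarrow> gram A (x - z' k) $ i = 0"
        using orth[OF kt] by blast
      then have "gram A (x - z' k) \<bullet> (x - z' k) = 0"
        unfolding inner_vec_def using supp[of k] k
        by (intro sum.neutral) (auto simp: supported_on_def)
      then have "A *v (x - z' k) = 0" by (simp add: inner_gram)
      moreover have "card ((T - S k) \<union> S k) \<le> N * K"
      proof -
        have "card ((T - S k) \<union> S k) \<le> (K - k) + N * k"
          using inv[OF kt] card_Un_le[of "T - S k" "S k"] by linarith
        also have "\<dots> \<le> N * (K - k) + N * k" using KN by simp
        also have "\<dots> = N * K" using tK k by (simp add: distrib_left[symmetric])
        finally show ?thesis .
      qed
      ultimately have "x - z' k = 0" using rip_injective[OF rip \<delta>1 supp[of k]] k by simp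
      then show False using nz[OF kt ne'] by simp
    qed
    then obtain j where j: "j \<in> T - S k" "gram A (x - z' k) $ j \<noteq> 0" by blast
    \<comment> \<open>If \<open>j\<close> itself was not selected, every selected index correlates
      at least as strongly.\<close>
    have "\<exists>i\<in>h. gram A (x - z' k) $ i \<noteq> 0"
    proof (cases "j \<in> h")
      case False
      have "h \<noteq> {}" using h KN by (auto simp: top_correlated_def)
      then obtain i where "i \<in> h" by auto
      then have "\<bar>gram A (x - z' k) $ j\<bar> \<le> \<bar>gram A (x - z' k) $ i\<bar>"
        using h(1) False r[of k] k by (auto simp: top_correlated_def gram_nth)
      then have "gram A (x - z' k) $ i \<noteq> 0" using j(2) by auto
      then show ?thesis using \<open>i \<in> h\<close> by blast
    qed (use j in auto)
    then obtain i where i: "i \<in> h" "gram A (x - z' k) $ i \<noteq> 0" by auto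
    have "norm (A *v x - A *v z' t) < norm (A *v x - A *v z' k)"
    proof (rule least_squares_less[OF ls[of t]])
      show "supported_on (S t) (z' k)"
        using ls[of k] k h(2) by (auto simp: least_squares_alt intro: supported_on_mono)
    qed (use i h in \<open>auto simp: gram_nth matrix_vector_mult_diff_distrib\<close>)
    then have "norm (r t) < norm (r k)"
      using r[of t] r[of k] k by (simp add: matrix_vector_mult_diff_distrib)
    then show False using stop tK k by (simp add: gomp_continue_def)
  qed
  \<comment> \<open>Now \<open>x\<close> is itself feasible with residual 0, so the minimal residual
    is 0 and injectivity on \<open>S t\<close> identifies the two vectors.\<close>
  have "supported_on (S t) x" using TS by (auto simp: supported_on_def T_def)
  then have "norm (A *v x - A *v z' t) \<le> norm (A *v x - A *v x)" and
    "supported_on (S t) (x - z' t)"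
    using ls[of t] by (auto simp: least_squares_alt intro: supported_on_diff)
  then have "A *v (x - z' t) = 0" and supp': "supported_on (S t) (x - z' t)"
    by (simp_all add: matrix_vector_mult_diff_distrib)
  then have "x - z' t = 0" using rip_injective[OF rip \<delta>1 supp' cardSt] by simp
  \<comment> \<open>Since \<open>t\<close> is positive, \<open>z'\<close> agrees with
    \<open>z\<close> there.\<close>
  then show ?thesis using t_le t_pos by (simp add: z'_def)
qed

text \<open>Correctness is stated for all runs, so this shows that it is not vacuous. Fixed choices
  of selection and estimate are iterated forever, and the sequence is cut where the loop condition
  first fails, at the latest at \<open>K\<close>; up to there RIP supplies full column rank.\<close>

lemma gomp_run_exists:
  fixes A :: "real ^ 'n ^ 'm"
  assumes rip: "rip_bounds A (N * K) \<delta>" "\<delta> < 1" and N: "N \<le> CARD('n)"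
  shows "\<exists>S z r t. gomp_run K N y A S z r t"
proof -
  obtain sel where sel: "\<And>r. top_correlated N A r (sel r)"
    using top_correlated_exists[OF N] by metis
  obtain est where est: "\<And>S. least_squares A y S (est S)"
    using least_squares_exists[of A y] by metis
  define S where "S = rec_nat {} (\<lambda>_ J. J \<union> sel (y - A *v est J))"
  define z where "z k = est (S k)" for k
  define r where "r k = y - A *v z k" for k
  define t where "t = (LEAST k. \<not> gomp_continue K r k)"
  have S: "S 0 = {}" "S (Suc k) = S k \<union> sel (r k)" for k
    by (simp_all add: S_def r_def z_def)
  have cont: "gomp_continue K r k" if "k < t" for k
    using that not_less_Least unfolding t_def by blast
  have stop: "\<not> gomp_continue K r t"
    unfolding t_def by (rule LeastI[of _ K]) (simp add: gomp_continue_def)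
  have cardS: "card (S k) \<le> N * k" for k
  proof (induction k)
    case (Suc k)
    then show ?case
      using card_Un_le[of "S k" "sel (r k)"] sel[of "r k"] by (simp add: S top_correlated_def)
  qed (simp add: S)
  have "full_column_rank A (S (Suc k))" if "k < t" for k
  proof (rule rip_full_column_rank[OF rip])
    have "k < K" using cont[OF that] by (simp add: gomp_continue_def)
    then show "card (S (Suc k)) \<le> N * K"
      using cardS[of "Suc k"] mult_le_mono2[of "Suc k" K N] by simp
  qed
  moreover have "r 0 = y"
  proof -
    have "z 0 = 0" using est[of "{}"]
      by (simp add: z_def S least_squares_alt supported_on_def vec_eq_iff)
    then show ?thesis by (simp add: r_def)
  qed
  ultimately have "gomp_run K N y A S z r t"
    unfolding gomp_run_def using S cont stop sel est
    by (intro conjI allI impI exI[of _ "sel (r _)"]) (simp_all add: z_def r_def)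
  then show ?thesis by blast
qed

text \<open>All runs are covered because ties may be broken arbitrarily. The bound on
  \<open>N\<close> in the existence part ensures that \<open>N\<close> distinct indices are
  available. The case K = N = 1 is excluded in view of \<open>gomp_failure_1_1\<close>.\<close>

theorem theorem1:
  fixes \<Phi> :: "real ^ 'n ^ 'm" and x :: "real ^ 'n" and y :: "real ^ 'm" and K N :: nat
  assumes "1 \<le> K" and "1 \<le> N" and "\<not> (K = 1 \<and> N = 1)"
    and "N * K < CARD('m)"
    and "k_sparse K x" and "y = \<Phi> *v x"
    and "satisfies_rip \<Phi> (N * K)"
    and "rip_const \<Phi> (N * K) < sqrt (real N) / (sqrt (real K) + 2 * sqrt (real N))"
  shows "(N \<le> CARD('n) \<longrightarrow> (\<exists>\<Lambda> z r t. gomp_run K N y \<Phi> \<Lambda> z r t)) \<and>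
         (\<forall>\<Lambda> z r t. gomp_run K N y \<Phi> \<Lambda> z r t \<longrightarrow> t \<le> K \<and> z t = x)"
proof (intro conjI impI allI)
  obtain \<delta> where "rip_bounds \<Phi> (N * K) \<delta>" "\<delta> < 1"
    using assms(7) by (auto simp: satisfies_rip_def)
  then show "\<exists>\<Lambda> z r t. gomp_run K N y \<Phi> \<Lambda> z r t" if "N \<le> CARD('n)"
    using that by (rule gomp_run_exists)
next
  \<comment> \<open>A positive order makes the infimum attained, so \<open>rip_const\<close> is
    itself an admissible constant.\<close>
  have "1 \<le> N * K" using assms(1,2) by (cases N; cases K) auto
  then have rip: "rip_bounds \<Phi> (N * K) (rip_const \<Phi> (N * K))"
    by (rule rip_bounds_rip_const[OF assms(7)])
  fix \<Lambda> z r t assume "gomp_run K N y \<Phi> \<Lambda> z r t"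
  then have "t \<le> K \<and> z t = x"
    unfolding assms(6) by (rule gomp_run_sound[OF rip assms(8,1,2,3,5)])
  then show "t \<le> K" "z t = x" by auto
qed

end
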